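(* Let $\mathcal{A}\in\mathbb{R}^{[m,n]}$ be a $Z$-tensor and $b\in\mathbb{R}^n$ with $b\ge 0$, and suppose that $\mathcal{S}_g=\{x\in\mathbb{R}^n\mid x\ge 0,\ \mathcal{A}x^{m-1}\ge b\}\ne\emptyset$. Let $\mathcal{A}=\mathcal{M}-\mathcal{N}$ be the level-1 splitting and $M$ the majorization matrix of $\mathcal{A}$. Let $M=P-Q$ and $M=\hat{P}-\hat{Q}$ be two splittings, where $P,\hat{P}$ are nonsingular $M$-matrices and $Q,\hat{Q}\ge 0$. Let $\{x_k\}$ and $\{\hat{x}_k\}$ be the sequences of nonnegative vectors given by $x_0=\hat{x}_0=0$ and, for $k\ge0$, $$P x_{k+1}^{[m-1]}=Q x_k^{[m-1]}+\mathcal{N}x_k^{m-1}+b,\qquad \hat{P}\hat{x}_{k+1}^{[m-1]}=\hat{Q}\hat{x}_k^{[m-1]}+\mathcal{N}\hat{x}_k^{m-1}+b.$$ If $\hat{Q}\le Q$, then $x_k\le\hat{x}_k$ for all $k\ge 0$.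
   Context: $\mathbb{R}^{[m,n]}$ ($m\ge 2$, $n\ge 1$) is the set of real $m$th-order $n$-dimensional tensors $\mathcal{A}=(a_{i_1i_2\ldots i_m})$, $1\le i_1,\ldots,i_m\le n$. For $x\in\mathbb{R}^n$, $\mathcal{A}x^{m-1}\in\mathbb{R}^n$ has entries $(\mathcal{A}x^{m-1})_i=\sum_{i_2,\ldots,i_m=1}^n a_{ii_2\ldots i_m}x_{i_2}\cdots x_{i_m}$. Diagonal elements are $a_{ii\ldots i}$; all others are off-diagonal. $\mathcal{A}$ is a $Z$-tensor if all its off-diagonal elements are nonpositive. Inequalities for vectors and matrices are entrywise. For $r>0$, $x^{[r]}$ is the entrywise power, $(x^{[r]})_i=(x_i)^r$. Level-1 splitting: $\mathcal{A}=\mathcal{M}-\mathcal{N}$, where $\mathcal{M}=(m_{i_1\ldots i_m})$ has $m_{ij\ldots j}=a_{ij\ldots j}$ for all $i,j\in\{1,\ldots,n\}$ and all other elements zero. The majorization matrix of $\mathcal{A}$ is the $n\times n$ matrix $M$ with $(i,j)$ entry $a_{ij\ldots j}$, so $\mathcal{M}x^{m-1}=Mx^{[m-1]}$. A nonsingular $M$-matrix is a matrix of the form $sI-B$ with $B\ge 0$ and $s>\rho(B)$. Explicitly, the iteration is $x_{k+1}=\left(P^{-1}(Qx_k^{[m-1]}+\mathcal{N}x_k^{m-1}+b)\right)^{[1/(m-1)]}$. *)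

theory Defs
  imports "Jordan_Normal_Form.Spectral_Radius"
begin

text \<open>Tensors of order m and dimension n are functions on index lists. Only the values on
  \<open>tensor_indices m n\<close> are meaningful; indices run over \<open>0, \<dots>, n - 1\<close>. Vectors, matrices and
  their entrywise orders are those of \<open>Jordan_Normal_Form.Matrix\<close>.\<close>

type_synonym tensor = "nat list \<Rightarrow> real"

definition tensor_indices :: "nat \<Rightarrow> nat \<Rightarrow> nat list set" where
  "tensor_indices m n = {is. length is = m \<and> set is \<subseteq> {..<n}}"

definition tensor_apply :: "nat \<Rightarrow> nat \<Rightarrow> tensor \<Rightarrow> real vec \<Rightarrow> real vec" where
  "tensor_apply m n A x =
     vec n (\<lambda>i. \<Sum>js\<in>tensor_indices (m - 1) n. A (i # js) * (\<Prod>l<m - 1. x $ (js ! l)))"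

definition Z_tensor :: "nat \<Rightarrow> nat \<Rightarrow> tensor \<Rightarrow> bool" where
  "Z_tensor m n A \<longleftrightarrow>
     (\<forall>is\<in>tensor_indices m n. (\<nexists>i. is = replicate m i) \<longrightarrow> A is \<le> 0)"

definition vec_pow :: "real vec \<Rightarrow> nat \<Rightarrow> real vec" where
  "vec_pow x r = map_vec (\<lambda>t. t ^ r) x"

definition level1_splitting :: "nat \<Rightarrow> nat \<Rightarrow> tensor \<Rightarrow> tensor \<Rightarrow> tensor \<Rightarrow> bool" where
  "level1_splitting m n A M N \<longleftrightarrow>
     (\<forall>is\<in>tensor_indices m n.
        M is = (if \<exists>i j. is = i # replicate (m - 1) j then A is else 0) \<and>
        A is = M is - N is)"

definition majorization_mat :: "nat \<Rightarrow> nat \<Rightarrow> tensor \<Rightarrow> real mat" where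
  "majorization_mat m n A = mat n n (\<lambda>(i, j). A (i # replicate (m - 1) j))"

definition nonsingular_M_matrix :: "nat \<Rightarrow> real mat \<Rightarrow> bool" where
  "nonsingular_M_matrix n P \<longleftrightarrow>
     (\<exists>s B. B \<in> carrier_mat n n \<and> 0\<^sub>m n n \<le> B \<and>
        s > spectral_radius (map_mat complex_of_real B) \<and> P = s \<cdot>\<^sub>m 1\<^sub>m n - B)"

definition S_g :: "nat \<Rightarrow> nat \<Rightarrow> tensor \<Rightarrow> real vec \<Rightarrow> real vec set" where
  "S_g m n A b = {x \<in> carrier_vec n. 0\<^sub>v n \<le> x \<and> b \<le> tensor_apply m n A x}"

end

theory Submission
  imports Defs
begin

text \<open>Since \<open>P = s I - B\<close> with \<open>B \<ge> 0\<close> and \<open>\<rho>(B) < s\<close>, an inequality \<open>P v \<ge> 0\<close> can be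
  iterated to \<open>v \<ge> (B / s)^k v\<close>, whose right-hand side tends to \<open>0\<close>; so \<open>P v \<le> P w\<close> implies
  \<open>v \<le> w\<close>. Let \<open>y\<^sub>k\<close>, \<open>y'\<^sub>k\<close> be the entrywise powers of \<open>x\<^sub>k\<close>, \<open>x'\<^sub>k\<close>. As \<open>\<N>\<close> is nonnegative,
  \<open>y'\<^sub>k\<close> increases with \<open>k\<close>. Adding \<open>P - P' = Q - Q' \<ge> 0\<close>, applied to \<open>y'\<^sub>k\<^sub>+\<^sub>1 \<ge> y'\<^sub>k\<close>, to the
  recursion for \<open>x'\<close> shows that \<open>P y'\<^sub>k\<^sub>+\<^sub>1\<close> is at least \<open>Q y'\<^sub>k + \<N> x'\<^sub>k\<^sup>m\<^sup>-\<^sup>1 + b\<close>, so induction on \<open>k\<close>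
  gives the comparison.\<close>

section \<open>Nonnegative matrices and the entrywise order\<close>

lemma mult_mat_vec_eq_sum:
  assumes "A \<in> carrier_mat nr nc" and "v \<in> carrier_vec nc" and "i < nr"
  shows "(A *\<^sub>v v) $ i = (\<Sum>j<nc. A $$ (i, j) * v $ j)"
  using assms by (simp add: scalar_prod_def atLeast0LessThan)

lemma mult_mat_vec_mono:
  fixes A :: "'a :: linordered_idom mat"
  assumes A: "A \<in> carrier_mat nr nc" and nonneg: "0\<^sub>m nr nc \<le> A"
    and v: "v \<in> carrier_vec nc" and w: "w \<in> carrier_vec nc" and le: "v \<le> w"
  shows "A *\<^sub>v v \<le> A *\<^sub>v w"
proof -
  have "(A *\<^sub>v v) $ i \<le> (A *\<^sub>v w) $ i" if i: "i < nr" for i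
    unfolding mult_mat_vec_eq_sum[OF A v i] mult_mat_vec_eq_sum[OF A w i]
    using A nonneg w le i
    by (intro sum_mono mult_left_mono) (auto simp: less_eq_mat_def less_eq_vec_def)
  then show ?thesis using A by (simp add: less_eq_vec_def)
qed

lemma mult_mat_nonneg:
  fixes A B :: "'a :: linordered_idom mat"
  assumes "A \<in> carrier_mat nr k" and "0\<^sub>m nr k \<le> A"
    and "B \<in> carrier_mat k nc" and "0\<^sub>m k nc \<le> B"
  shows "0\<^sub>m nr nc \<le> A * B"
  using assms by (auto simp: less_eq_mat_def scalar_prod_def intro!: sum_nonneg)

lemma pow_mat_nonneg:
  fixes A :: "'a :: linordered_idom mat"
  assumes A: "A \<in> carrier_mat n n" and nonneg: "0\<^sub>m n n \<le> A"
  shows "0\<^sub>m n n \<le> A ^\<^sub>m k"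
proof (induction k)
  case 0
  then show ?case using A by (auto simp: less_eq_mat_def one_mat_def)
next
  case (Suc k)
  then show ?case using mult_mat_nonneg[OF pow_carrier_mat[OF A] _ A nonneg] by simp
qed

section \<open>Spectral radius and inverse positivity of nonsingular M-matrices\<close>

lemma spectral_radius_nonneg:
  assumes "A \<in> carrier_mat n n" and "n > 0"
  shows "0 \<le> spectral_radius A"
  using spectral_radius_mem_max(1)[OF assms] by auto

text \<open>Division by \<open>t\<close> moves all eigenvalues strictly inside the unit disc, and
  the Jordan normal form then bounds all powers at once.\<close>

lemma norm_bound_pow_mat_scaled:
  fixes A :: "complex mat"
  assumes A: "A \<in> carrier_mat n n" and n: "n > 0" and t: "spectral_radius A < t"
  shows "\<exists>c. \<forall>k. norm_bound ((complex_of_real (1 / t) \<cdot>\<^sub>m A) ^\<^sub>m k) c"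
proof -
  let ?C = "complex_of_real (1 / t) \<cdot>\<^sub>m A"
  have C: "?C \<in> carrier_mat n n" using A by simp
  have t0: "t > 0" using t spectral_radius_nonneg[OF A n] by linarith
  have "norm a < 1" if a: "a \<in> spectrum ?C" for a
  proof -
    obtain v where v: "v \<in> carrier_vec n" "v \<noteq> 0\<^sub>v n" and eq: "?C *\<^sub>v v = a \<cdot>\<^sub>v v"
      using a A by (auto simp: spectrum_def eigenvalue_def eigenvector_def)
    \<comment> \<open>An eigenvector of \<open>?C\<close> for \<open>a\<close> is one of
      \<open>A\<close> for \<open>t * a\<close>, so the bound on the spectrum of \<open>A\<close>
      controls \<open>norm a\<close>.\<close>
    have "A *\<^sub>v v = (complex_of_real t * a) \<cdot>\<^sub>v v"
    proof (rule eq_vecI)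
      fix i assume "i < dim_vec ((complex_of_real t * a) \<cdot>\<^sub>v v)"
      then have i: "i < n" using v by simp
      have "(?C *\<^sub>v v) $ i = complex_of_real (1 / t) * (A *\<^sub>v v) $ i"
        using A v i by simp
      then show "(A *\<^sub>v v) $ i = ((complex_of_real t * a) \<cdot>\<^sub>v v) $ i"
        using eq v i t0 by (simp add: field_simps)
    qed (use A v in simp)
    then have "complex_of_real t * a \<in> spectrum A"
      using A v by (auto simp: spectrum_def eigenvalue_def eigenvector_def)
    then have "norm (complex_of_real t * a) \<le> spectral_radius A"
      using spectral_radius_mem_max(2)[OF A n] by blast
    then have "t * norm a \<le> spectral_radius A" using t0 by (simp add: norm_mult)
    then have "t * norm a < t * 1" using t by linarith
    then show ?thesis by (rule mult_left_less_imp_less) (use t0 in simp)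
  qed
  then have "spectral_radius ?C < 1"
    using spectral_radius_mem_max(1)[OF C n] by auto
  \<comment> \<open>Over the complex numbers the characteristic polynomial splits into linear
    factors.\<close>
  moreover have "\<exists>n_as. jordan_nf ?C n_as"
    using char_poly_factorized[OF C] jordan_nf_exists[OF C] by blast
  ultimately show ?thesis by (rule spectral_radius_jnf_norm_bound_less_1[OF C])
qed

text \<open>With \<open>\<rho>(B) < t < s\<close>, factor \<open>B / s = q C\<close>, where
  \<open>C = B / t\<close> and \<open>q = t / s < 1\<close>. The powers of \<open>C\<close> are only
  known to be bounded; the geometric factor \<open>q ^ k\<close> supplies the decay.\<close>

lemma nonsingular_M_matrix_nonneg:
  assumes n: "n > 0" and P: "nonsingular_M_matrix n P" and v: "v \<in> carrier_vec n"
    and Pv: "0\<^sub>v n \<le> P *\<^sub>v v"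
  shows "0\<^sub>v n \<le> v"
proof -
  obtain s B where B: "B \<in> carrier_mat n n" and B0: "0\<^sub>m n n \<le> B"
    and s: "s > spectral_radius (map_mat complex_of_real B)" and P_eq: "P = s \<cdot>\<^sub>m 1\<^sub>m n - B"
    using P unfolding nonsingular_M_matrix_def by blast
  let ?B = "map_mat complex_of_real B"
  have cB: "?B \<in> carrier_mat n n" using B by simp
  obtain t where t: "spectral_radius ?B < t" "t < s" using s dense by blast
  have t0: "t > 0" and s0: "s > 0" using spectral_radius_nonneg[OF cB n] t by linarith+
  define C where "C = (1 / t) \<cdot>\<^sub>m B"
  have C: "C \<in> carrier_mat n n" using B by (simp add: C_def)
  have C0: "0\<^sub>m n n \<le> C" using B B0 t0 by (auto simp: C_def less_eq_mat_def)
  have Ck: "C ^\<^sub>m k \<in> carrier_mat n n" for k using C by simp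
  have map_C: "map_mat complex_of_real C = complex_of_real (1 / t) \<cdot>\<^sub>m ?B"
    by (auto simp: C_def)
  obtain c where "\<forall>k. norm_bound ((map_mat complex_of_real C) ^\<^sub>m k) c"
    using norm_bound_pow_mat_scaled[OF cB n t(1)] unfolding map_C by blast
  \<comment> \<open>The embedding of the reals commutes with matrix powers, which carries the
    complex bound back to the real matrix \<open>C\<close>.\<close>
  then have c: "norm_bound (map_mat complex_of_real (C ^\<^sub>m k)) c" for k
    by (simp add: of_real_hom.mat_hom_pow[OF C])
  have bound: "\<bar>(C ^\<^sub>m k) $$ (i, j)\<bar> \<le> c" if "i < n" "j < n" for i j k
    using c[of k] carrier_matD[OF Ck[of k]] that by (auto simp: norm_bound_def simp del: pow_mat_dim)
  define q where "q = t / s"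
  have q: "0 < q" "q < 1" using t t0 s0 by (auto simp: q_def)
  \<comment> \<open>The hypothesis \<open>P v \<ge> 0\<close> reads \<open>B v \<le> s v\<close>;
    division by \<open>s\<close> gives the claim, since \<open>q / t = 1 / s\<close>.\<close>
  have Cv: "q \<cdot>\<^sub>v (C *\<^sub>v v) \<le> v"
  proof -
    have "(q \<cdot>\<^sub>v (C *\<^sub>v v)) $ i \<le> v $ i" if i: "i < n" for i
    proof -
      have "(s \<cdot>\<^sub>m 1\<^sub>m n) *\<^sub>v v = s \<cdot>\<^sub>v v"
        using v by (intro eq_vecI) auto
      then have "P *\<^sub>v v = s \<cdot>\<^sub>v v - B *\<^sub>v v"
        unfolding P_eq using B v by (subst minus_mult_distrib_mat_vec[of _ n n]) auto
      moreover have "0 \<le> (P *\<^sub>v v) $ i"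
        using Pv i by (auto simp: less_eq_vec_def)
      ultimately have "(B *\<^sub>v v) $ i \<le> s * v $ i" using B v i by simp
      moreover have "(C *\<^sub>v v) $ i = (1 / t) * (B *\<^sub>v v) $ i"
        using B v i by (simp add: C_def)
      ultimately show ?thesis
        using C v i t0 s0 by (simp add: q_def field_simps)
    qed
    then show ?thesis using v C by (simp add: less_eq_vec_def)
  qed
  have iter: "q ^ k \<cdot>\<^sub>v (C ^\<^sub>m k *\<^sub>v v) \<le> v" for k
  proof (induction k)
    case 0
    then show ?case using v C by simp
  next
    case (Suc k)
    \<comment> \<open>Multiplying \<open>Cv\<close> from the left by the nonnegative matrix
      \<open>C ^ k\<close> matches the recursion of matrix powers, which appends a factor on the
      right.\<close>
    have "C ^\<^sub>m k *\<^sub>v (q \<cdot>\<^sub>v (C *\<^sub>v v)) \<le> C ^\<^sub>m k *\<^sub>v v"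
      by (rule mult_mat_vec_mono[OF Ck pow_mat_nonneg[OF C C0] _ v Cv]) (use C v in simp)
    moreover have "C ^\<^sub>m k *\<^sub>v (q \<cdot>\<^sub>v (C *\<^sub>v v)) = q \<cdot>\<^sub>v (C ^\<^sub>m Suc k *\<^sub>v v)"
      using C v Ck[of k] by (simp add: mult_mat_vec[of _ n n] assoc_mult_mat_vec[of _ n n _ n])
    ultimately have "q \<cdot>\<^sub>v (C ^\<^sub>m Suc k *\<^sub>v v) \<le> C ^\<^sub>m k *\<^sub>v v" by metis
    then have "q ^ Suc k \<cdot>\<^sub>v (C ^\<^sub>m Suc k *\<^sub>v v) \<le> q ^ k \<cdot>\<^sub>v (C ^\<^sub>m k *\<^sub>v v)"
      using q(1) mult_left_mono[of _ _ "q ^ k"]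
      by (auto simp: less_eq_vec_def mult.assoc mult.left_commute simp del: pow_mat.simps index_mult_mat_vec)
    then show ?case using Suc.IH by (rule order_trans)
  qed
  have "0 \<le> v $ i" if i: "i < n" for i
  proof -
    \<comment> \<open>\<open>K\<close> bounds the entries of \<open>C ^ k v\<close> uniformly in
      \<open>k\<close>, so \<open>v $ i\<close> lies above a sequence tending to
      \<open>0\<close>.\<close>
    define K where "K = (\<Sum>j<n. c * \<bar>v $ j\<bar>)"
    have "- (q ^ k * K) \<le> v $ i" for k
    proof -
      have "\<bar>(C ^\<^sub>m k *\<^sub>v v) $ i\<bar> \<le> (\<Sum>j<n. \<bar>(C ^\<^sub>m k) $$ (i, j) * v $ j\<bar>)"
        unfolding mult_mat_vec_eq_sum[OF Ck v i] by (rule sum_abs)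
      also have "\<dots> \<le> K"
        unfolding K_def abs_mult using bound i by (intro sum_mono mult_right_mono) auto
      finally have "q ^ k * (- K) \<le> q ^ k * (C ^\<^sub>m k *\<^sub>v v) $ i"
        using q(1) by (intro mult_left_mono) auto
      also have "\<dots> \<le> v $ i"
        using iter[of k] v Ck[of k] i
        by (auto simp: less_eq_vec_def simp del: index_mult_mat_vec)
      finally show ?thesis by simp
    qed
    moreover have "(\<lambda>k. - (q ^ k * K)) \<longlonglongrightarrow> - (0 * K)"
      using q by (intro tendsto_intros LIMSEQ_power_zero) auto
    ultimately have "- (0 * K) \<le> v $ i" by (intro LIMSEQ_le_const2) auto
    then show ?thesis by simp
  qed
  then show ?thesis using v by (simp add: less_eq_vec_def)
qed

text \<open>By linearity this is inverse positivity applied to \<open>w - v\<close>. It cancels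
  \<open>P\<close> in the recursions without forming an inverse.\<close>

lemma nonsingular_M_matrix_le:
  assumes "n > 0" and "nonsingular_M_matrix n P" and P: "P \<in> carrier_mat n n"
    and v: "v \<in> carrier_vec n" and w: "w \<in> carrier_vec n" and le: "P *\<^sub>v v \<le> P *\<^sub>v w"
  shows "v \<le> w"
proof -
  have "0 \<le> (P *\<^sub>v w - P *\<^sub>v v) $ i" if "i < n" for i
    using le P that by (simp add: less_eq_vec_def del: index_mult_mat_vec)
  then have "0\<^sub>v n \<le> P *\<^sub>v w - P *\<^sub>v v"
    using P by (simp add: less_eq_vec_def del: index_mult_mat_vec index_minus_vec(1))
  then have "0\<^sub>v n \<le> P *\<^sub>v (w - v)"
    by (simp only: mult_minus_distrib_mat_vec[OF P w v])
  with assms(1,2) have "0\<^sub>v n \<le> w - v"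
    by (rule nonsingular_M_matrix_nonneg[OF _ _ minus_carrier_vec[OF w v]])
  then show ?thesis using v w by (simp add: less_eq_vec_def)
qed

section \<open>Monotonicity of the tensor remainder and of entrywise powers\<close>

lemma level1_remainder_nonneg:
  assumes "m \<ge> 1" and Z: "Z_tensor m n A" and split: "level1_splitting m n A M N"
    and "is": "is \<in> tensor_indices m n"
  shows "0 \<le> N is"
proof -
  have M: "M is = (if \<exists>i j. is = i # replicate (m - 1) j then A is else 0)"
    and N: "A is = M is - N is"
    using bspec[OF split[unfolded level1_splitting_def] "is"] by blast+
  show ?thesis
  proof (cases "\<exists>i j. is = i # replicate (m - 1) j")
    case True
    then have "M is = A is" unfolding M by (rule if_P)
    then show ?thesis using N by simp
  next
    case False
    \<comment> \<open>A diagonal index is the case \<open>i = j\<close> of the pattern kept in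
      \<open>M\<close>, so an index outside the pattern is off-diagonal and the sign condition on
      \<open>A\<close> applies.\<close>
    have "replicate m i = i # replicate (m - 1) i" for i
      using \<open>m \<ge> 1\<close> by (cases m) auto
    then have "\<nexists>i. is = replicate m i" using False by metis
    then have "A is \<le> 0" using Z "is" unfolding Z_tensor_def by blast
    moreover have "M is = 0" unfolding M using False by (rule if_not_P)
    ultimately show ?thesis using N by simp
  qed
qed

text \<open>With nonnegative coefficients it suffices to compare monomials, and products of
  nonnegative factors are monotone in each factor.\<close>

lemma tensor_apply_mono:
  assumes nonneg: "\<And>is. is \<in> tensor_indices m n \<Longrightarrow> 0 \<le> N is" and "m \<ge> 1"
    and "y \<in> carrier_vec n" and "0\<^sub>v n \<le> x" and "x \<le> y"
  shows "tensor_apply m n N x \<le> tensor_apply m n N y"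
proof -
  have "N (i # js) * (\<Prod>l<m - 1. x $ (js ! l)) \<le> N (i # js) * (\<Prod>l<m - 1. y $ (js ! l))"
    if "i < n" and js: "js \<in> tensor_indices (m - 1) n" for i js
  proof (intro mult_left_mono prod_mono conjI)
    show "0 \<le> N (i # js)"
      using that \<open>m \<ge> 1\<close> by (intro nonneg) (auto simp: tensor_indices_def)
    fix l assume "l \<in> {..<m - 1}"
    then have "js ! l \<in> set js" using js by (auto simp: tensor_indices_def)
    then have "js ! l < n" using js by (auto simp: tensor_indices_def)
    then show "0 \<le> x $ (js ! l)" "x $ (js ! l) \<le> y $ (js ! l)"
      using assms by (auto simp: less_eq_vec_def)
  qed
  then show ?thesis
    by (auto simp: tensor_apply_def less_eq_vec_def intro!: sum_mono)
qed

lemma tensor_apply_carrier: "tensor_apply m n A x \<in> carrier_vec n"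
  by (simp add: tensor_apply_def)

lemma vec_pow_carrier: "x \<in> carrier_vec n \<Longrightarrow> vec_pow x r \<in> carrier_vec n"
  by (simp add: vec_pow_def)

text \<open>A positive power is strictly increasing on the nonnegative reals. The equivalence passes
  between iterates and their powers without taking roots.\<close>

lemma vec_pow_le_iff:
  assumes "x \<in> carrier_vec n" and "y \<in> carrier_vec n" and "0\<^sub>v n \<le> x" and "0\<^sub>v n \<le> y"
    and "r > 0"
  shows "vec_pow x r \<le> vec_pow y r \<longleftrightarrow> x \<le> y"
  using assms by (auto simp: vec_pow_def less_eq_vec_def)

lemma add_mono_vec:
  fixes u :: "'a :: ordered_ab_semigroup_add vec"
  assumes "u \<le> u'" and "v \<le> v'" and "u' \<in> carrier_vec n" and "v' \<in> carrier_vec n"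
  shows "u + v \<le> u' + v'"
  using assms by (auto simp: less_eq_vec_def intro: add_mono)

section \<open>Comparison of the two iterations\<close>

theorem theorem10:
  fixes m n :: nat
    and \<A> \<M> \<N> :: tensor
    and b :: "real vec"
    and P Q P' Q' :: "real mat"
    and x x' :: "nat \<Rightarrow> real vec"
  assumes "m \<ge> 2" and "n \<ge> 1"
    and "Z_tensor m n \<A>"
    and "b \<in> carrier_vec n" and "0\<^sub>v n \<le> b"
    and "S_g m n \<A> b \<noteq> {}"
    and "level1_splitting m n \<A> \<M> \<N>"
    and "P \<in> carrier_mat n n" and "Q \<in> carrier_mat n n"
    and "majorization_mat m n \<A> = P - Q"
    and "nonsingular_M_matrix n P" and "0\<^sub>m n n \<le> Q"
    and "P' \<in> carrier_mat n n" and "Q' \<in> carrier_mat n n"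
    and "majorization_mat m n \<A> = P' - Q'"
    and "nonsingular_M_matrix n P'" and "0\<^sub>m n n \<le> Q'"
    and "\<And>k. x k \<in> carrier_vec n" and "\<And>k. 0\<^sub>v n \<le> x k"
    and "x 0 = 0\<^sub>v n"
    and "\<And>k. P *\<^sub>v vec_pow (x (Suc k)) (m - 1) =
          Q *\<^sub>v vec_pow (x k) (m - 1) + tensor_apply m n \<N> (x k) + b"
    and "\<And>k. x' k \<in> carrier_vec n" and "\<And>k. 0\<^sub>v n \<le> x' k"
    and "x' 0 = 0\<^sub>v n"
    and "\<And>k. P' *\<^sub>v vec_pow (x' (Suc k)) (m - 1) =
          Q' *\<^sub>v vec_pow (x' k) (m - 1) + tensor_apply m n \<N> (x' k) + b"
    and "Q' \<le> Q"
  shows "\<forall>k. x k \<le> x' k"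
proof
  note m = assms(1) and n = assms(2) and Z = assms(3) and b = assms(4) and split = assms(7)
    and P = assms(8) and Q = assms(9) and PQ = assms(10) and PM = assms(11) and Q0 = assms(12)
    and P' = assms(13) and Q' = assms(14) and PQ' = assms(15) and PM' = assms(16)
    and Q0' = assms(17) and x = assms(18) and x0 = assms(19) and init = assms(20)
    and step = assms(21) and x' = assms(22) and x0' = assms(23) and init' = assms(24)
    and step' = assms(25) and QQ = assms(26)
  define y where "y k = vec_pow (x k) (m - 1)" for k
  define y' where "y' k = vec_pow (x' k) (m - 1)" for k
  have y: "y k \<in> carrier_vec n" and y': "y' k \<in> carrier_vec n" for k
    using x x' by (auto simp: y_def y'_def vec_pow_carrier)
  have r: "m - 1 > 0" and n0: "n > 0" using m n by auto
  have mono_N: "tensor_apply m n \<N> u \<le> tensor_apply m n \<N> w"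
    if "w \<in> carrier_vec n" "0\<^sub>v n \<le> u" "u \<le> w" for u w
    using level1_remainder_nonneg[OF _ Z split] m that by (intro tensor_apply_mono) auto
  \<comment> \<open>The start at \<open>0\<close> gives the first inequality; afterwards the
    right-hand side of the recursion is monotone in the iterate and \<open>P'\<close>
    cancels.\<close>
  have incr: "x' k \<le> x' (Suc k)" for k
  proof (induction k)
    case 0
    then show ?case using x0' init' by simp
  next
    case (Suc k)
    then have "y' k \<le> y' (Suc k)"
      unfolding y'_def using vec_pow_le_iff[OF x' x' x0' x0' r] by blast
    then have "P' *\<^sub>v y' (Suc k) \<le> P' *\<^sub>v y' (Suc (Suc k))"
      unfolding step'[folded y'_def]
      using mult_mat_vec_mono[OF Q' Q0' y' y'] mono_N[OF x' x0' Suc.IH] Q' y' b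
      by (intro add_mono_vec[of _ _ _ _ n]) (auto simp: tensor_apply_carrier)
    then have "y' (Suc k) \<le> y' (Suc (Suc k))"
      by (rule nonsingular_M_matrix_le[OF n0 PM' P' y' y'])
    then show ?case
      unfolding y'_def using vec_pow_le_iff[OF x' x' x0' x0' r] by blast
  qed
  \<comment> \<open>The sequence \<open>x'\<close> is a supersolution of the recursion with
    \<open>P\<close> and \<open>Q\<close>: replacing \<open>P'\<close>, \<open>Q'\<close> by
    \<open>P\<close>, \<open>Q\<close> adds \<open>D y'\<close> at index \<open>k\<close> on one
    side and at index \<open>k + 1\<close> on the other.\<close>
  have super: "Q *\<^sub>v y' k + tensor_apply m n \<N> (x' k) + b \<le> P *\<^sub>v y' (Suc k)" for k
  proof -
    define D where "D = Q - Q'"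
    have D: "D \<in> carrier_mat n n" using minus_carrier_mat[OF Q'] by (simp add: D_def)
    have D0: "0\<^sub>m n n \<le> D" using QQ Q Q' by (auto simp: D_def less_eq_mat_def)
    \<comment> \<open>Both splittings have the same majorization matrix, so the difference
      \<open>D\<close> of \<open>Q\<close> and \<open>Q'\<close> is also that of \<open>P\<close>
      and \<open>P'\<close>.\<close>
    have entry: "P $$ (i, j) - Q $$ (i, j) = P' $$ (i, j) - Q' $$ (i, j)"
      if "i < n" "j < n" for i j
    proof -
      have "P $$ (i, j) - Q $$ (i, j) = (P - Q) $$ (i, j)" using Q that by simp
      also have "\<dots> = (P' - Q') $$ (i, j)" using PQ PQ' by simp
      also have "\<dots> = P' $$ (i, j) - Q' $$ (i, j)" using Q' that by simp
      finally show ?thesis .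
    qed
    have P_eq: "P = P' + D"
    proof (rule eq_matI)
      fix i j assume "i < dim_row (P' + D)" "j < dim_col (P' + D)"
      then show "P $$ (i, j) = (P' + D) $$ (i, j)"
        using entry[of i j] D Q Q' by (simp add: D_def)
    qed (use P D in auto)
    have Q_eq: "Q = Q' + D"
      using Q Q' by (intro eq_matI) (auto simp: D_def)
    have "y' k \<le> y' (Suc k)"
      unfolding y'_def using incr vec_pow_le_iff[OF x' x' x0' x0' r] by blast
    then have D_le: "D *\<^sub>v y' k \<le> D *\<^sub>v y' (Suc k)"
      by (rule mult_mat_vec_mono[OF D D0 y' y'])
    have "Q *\<^sub>v y' k + tensor_apply m n \<N> (x' k) + b = P' *\<^sub>v y' (Suc k) + D *\<^sub>v y' k"
      unfolding step'[of k, folded y'_def] Q_eq add_mult_distrib_mat_vec[OF Q' D y']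
      using Q' D y' tensor_apply_carrier b by (intro eq_vecI) (auto simp: tensor_apply_def)
    also have "\<dots> \<le> P' *\<^sub>v y' (Suc k) + D *\<^sub>v y' (Suc k)"
      using P' D y' by (intro add_mono_vec[OF order_refl D_le, of _ n]) auto
    also have "\<dots> = P *\<^sub>v y' (Suc k)"
      unfolding P_eq add_mult_distrib_mat_vec[OF P' D y'] ..
    finally show ?thesis .
  qed
  fix k
  show "x k \<le> x' k"
  proof (induction k)
    case 0
    then show ?case using init init' by simp
  next
    case (Suc k)
    then have "y k \<le> y' k"
      unfolding y_def y'_def using vec_pow_le_iff[OF x x' x0 x0' r] by blast
    \<comment> \<open>Monotonicity replaces \<open>x k\<close> by \<open>x' k\<close> on the right
      of the recursion for \<open>x\<close>; \<open>super\<close> then bounds the result by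
      \<open>P\<close> applied to \<open>y' (Suc k)\<close>.\<close>
    then have "P *\<^sub>v y (Suc k) \<le> Q *\<^sub>v y' k + tensor_apply m n \<N> (x' k) + b"
      unfolding step[of k, folded y_def]
      using mult_mat_vec_mono[OF Q Q0 y y'] mono_N[OF x' x0 Suc.IH] Q y' b
      by (intro add_mono_vec[of _ _ _ _ n]) (auto simp: tensor_apply_carrier)
    also note super
    finally have "y (Suc k) \<le> y' (Suc k)"
      by (rule nonsingular_M_matrix_le[OF n0 PM P y y'])
    then show ?case
      unfolding y_def y'_def using vec_pow_le_iff[OF x x' x0 x0' r] by blast
  qed
qed

end
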